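(* The poset $\mathcal{W}_{\omega}$ has the following properties: (1) $\mathcal{W}_{\omega}$ contains an antichain of cardinality $\mathfrak{c}$; (2) for each ordinal $\kappa\in\hat{\mathfrak{t}}$ (i.e. $\kappa<\hat{\mathfrak{t}}$) the poset $\mathcal{W}_{\omega}$ contains a well-ordered chain of order type $\kappa$; (3) $|\mathcal{W}_{\omega}|=|\mathcal{SCT}_{\omega}|=\mathfrak{c}$.
   Context: All topologies are assumed Hausdorff. $\omega$ is the set of non-negative integers, $\mathfrak{c}=2^{\omega}$ is the cardinality of the continuum. The bicyclic monoid $\mathcal{C}$ is the set $\omega\times\omega$ with the operation $(a,b)\cdot(c,d)=(a+c-b,d)$ if $b\le c$ and $(a,b)\cdot(c,d)=(a,d+b-c)$ if $b>c$. $\mathcal{C}^0=\mathcal{C}\cup\{0\}$ is $\mathcal{C}$ with an adjoined zero $0$. A topology on a semigroup is shift-continuous if the semigroup operation is separately continuous. The topology $\tau_{\min}$ on $\mathcal{C}^0$ (the coarsest Hausdorff topology making $\mathcal{C}^0$ a topological inverse semigroup) is the one in which all elements of $\mathcal{C}$ are isolated and the sets $C_n=\{0\}\cup\{(k,m)\mid k,m>n\}$, $n\in\omega$, form an open neighborhood base at $0$. A Hausdorff topology $\tau$ on $\mathcal{C}^0$ is weak if $\tau\subseteq\tau_{\min}$. $\mathcal{SCT}_{\omega}$ (resp. $\mathcal{W}_{\omega}$) is the set of all (resp. all weak) Hausdorff shift-continuous first-countable topologies on $\mathcal{C}^0$, ordered by inclusion. An antichain is a subset in which any two distinct elements are incomparable.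 $[\omega]^{\omega}$ is the family of infinite subsets of $\omega$, and $A\subset^* B$ means that $A\setminus B$ is finite. An infinite set $A\subseteq\omega$ is a pseudo-intersection of a family $\mathcal{F}\subseteq[\omega]^{\omega}$ if $A\subset^* F$ for each $F\in\mathcal{F}$. A tower is a set $\mathcal{T}\subseteq[\omega]^{\omega}$ which is well-ordered with respect to the relation $x\le y$ iff $y\subset^* x$. A tower is maximal if it cannot be further extended, i.e. it has no pseudo-intersection. $\hat{\mathfrak{t}}=\sup\{|\mathcal{T}| : \mathcal{T}\text{ is a maximal tower}\}$. *)

theory Defs
  imports "HOL-Analysis.Analysis"
begin

unbundle cardinal_syntax

section \<open>The bicyclic monoid with adjoined zero\<close>

datatype bicyclic0 = Zero | Elt nat nat

instantiation bicyclic0 :: "{semigroup_mult, mult_zero}"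
begin

definition zero_bicyclic0 :: bicyclic0 where
  "zero_bicyclic0 = Zero"

fun times_bicyclic0 :: "bicyclic0 \<Rightarrow> bicyclic0 \<Rightarrow> bicyclic0" where
  "times_bicyclic0 (Elt a b) (Elt c d) =
     (if b \<le> c then Elt (a + c - b) d else Elt a (d + b - c))"
| "times_bicyclic0 _ _ = Zero"

instance
proof
  fix x y z :: bicyclic0
  show "x * y * z = x * (y * z)"
    by (cases x; cases y; cases z) auto
  show "0 * x = 0" and "x * 0 = 0"
    by (cases x; simp add: zero_bicyclic0_def)+
qed

end

section \<open>Shift-continuous topologies\<close>

definition topology_le :: "'a topology \<Rightarrow> 'a topology \<Rightarrow> bool"  (infix \<open>\<sqsubseteq>\<^sub>T\<close> 50) where
  "\<sigma> \<sqsubseteq>\<^sub>T \<tau> \<longleftrightarrow> {U. openin \<sigma> U} \<subseteq> {U. openin \<tau> U}"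

definition shift_continuous :: "'a::semigroup_mult topology \<Rightarrow> bool" where
  "shift_continuous \<tau> \<longleftrightarrow>
     (\<forall>a. continuous_map \<tau> \<tau> (\<lambda>x. a * x) \<and> continuous_map \<tau> \<tau> (\<lambda>x. x * a))"

definition C_nbhd :: "nat \<Rightarrow> bicyclic0 set" where
  "C_nbhd n = {0} \<union> {Elt k m | k m. k > n \<and> m > n}"

definition tau_min :: "bicyclic0 topology" where
  "tau_min = topology (\<lambda>U. 0 \<in> U \<longrightarrow> (\<exists>n. C_nbhd n \<subseteq> U))"

lemma openin_tau_min: "openin tau_min U \<longleftrightarrow> (0 \<in> U \<longrightarrow> (\<exists>n. C_nbhd n \<subseteq> U))"
proof -
  have "istopology (\<lambda>U. 0 \<in> U \<longrightarrow> (\<exists>n. C_nbhd n \<subseteq> U))"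
    unfolding istopology_def
  proof (intro conjI allI impI)
    fix S T :: "bicyclic0 set"
    assume S: "0 \<in> S \<longrightarrow> (\<exists>n. C_nbhd n \<subseteq> S)" and T: "0 \<in> T \<longrightarrow> (\<exists>n. C_nbhd n \<subseteq> T)"
      and "0 \<in> S \<inter> T"
    then obtain m n where "C_nbhd m \<subseteq> S" "C_nbhd n \<subseteq> T" by auto
    moreover have "C_nbhd (max m n) \<subseteq> C_nbhd m \<inter> C_nbhd n"
      by (auto simp: C_nbhd_def)
    ultimately show "\<exists>n. C_nbhd n \<subseteq> S \<inter> T" by blast
  next
    fix K :: "bicyclic0 set set"
    assume "\<forall>S\<in>K. 0 \<in> S \<longrightarrow> (\<exists>n. C_nbhd n \<subseteq> S)" "0 \<in> \<Union>K"
    then show "\<exists>n. C_nbhd n \<subseteq> \<Union>K" by (meson Sup_upper UnionE order_trans)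
  qed
  then show ?thesis by (simp add: tau_min_def)
qed

text \<open>A topology on the whole semigroup is a topology whose \<^const>\<open>topspace\<close> is \<^term>\<open>UNIV\<close>.\<close>

definition SCT_omega :: "bicyclic0 topology set" where
  "SCT_omega = {\<tau>. topspace \<tau> = UNIV \<and> Hausdorff_space \<tau> \<and> shift_continuous \<tau> \<and> first_countable \<tau>}"

definition W_omega :: "bicyclic0 topology set" where
  "W_omega = {\<tau> \<in> SCT_omega. \<tau> \<sqsubseteq>\<^sub>T tau_min}"

definition topology_antichain :: "'a topology set \<Rightarrow> bool" where
  "topology_antichain A \<longleftrightarrow> pairwise (\<lambda>\<sigma> \<tau>. \<not> \<sigma> \<sqsubseteq>\<^sub>T \<tau> \<and> \<not> \<tau> \<sqsubseteq>\<^sub>T \<sigma>) A"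

definition topology_order :: "'a topology set \<Rightarrow> 'a topology rel" where
  "topology_order A = {(\<sigma>, \<tau>). \<sigma> \<in> A \<and> \<tau> \<in> A \<and> \<sigma> \<sqsubseteq>\<^sub>T \<tau>}"

section \<open>Towers\<close>

definition almost_subset :: "nat set \<Rightarrow> nat set \<Rightarrow> bool"  (infix \<open>\<subseteq>\<^sup>*\<close> 50) where
  "A \<subseteq>\<^sup>* B \<longleftrightarrow> finite (A - B)"

definition pseudo_intersection :: "nat set \<Rightarrow> nat set set \<Rightarrow> bool" where
  "pseudo_intersection A F \<longleftrightarrow> infinite A \<and> (\<forall>B\<in>F. A \<subseteq>\<^sup>* B)"

text \<open>The order of a tower is reverse almost inclusion. Well-ordering includes antisymmetry, so
  distinct members of a tower are never almost equal.\<close>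

definition tower :: "nat set set \<Rightarrow> bool" where
  "tower T \<longleftrightarrow> (\<forall>A\<in>T. infinite A) \<and>
     well_order_on T {(x, y). x \<in> T \<and> y \<in> T \<and> y \<subseteq>\<^sup>* x}"

definition maximal_tower :: "nat set set \<Rightarrow> bool" where
  "maximal_tower T \<longleftrightarrow> tower T \<and> (\<nexists>A. pseudo_intersection A T)"

section \<open>Cardinals\<close>

definition continuum :: "(nat \<Rightarrow> bool) rel" where
  "continuum = ctwo ^c natLeq"

text \<open>Cardinals are represented by cardinal orders, up to \<open>=o\<close>. Every tower is a set of subsets of
  \<^typ>\<open>nat\<close>, so the supremum of the cardinalities has a representative of type \<^typ>\<open>nat set rel\<close>; the lemma
  \<open>is_t_hat_least\<close> below shows that it is the least upper bound among the cardinals of all types.\<close>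

definition is_t_hat :: "nat set rel \<Rightarrow> bool" where
  "is_t_hat t \<longleftrightarrow> Card_order t \<and> (\<forall>T. maximal_tower T \<longrightarrow> |T| \<le>o t) \<and>
     (\<forall>s :: nat set rel. Card_order s \<and> (\<forall>T. maximal_tower T \<longrightarrow> |T| \<le>o s) \<longrightarrow> t \<le>o s)"

definition t_hat :: "nat set rel" where
  "t_hat = (SOME t. is_t_hat t)"

lemma is_t_hat_t_hat: "is_t_hat t_hat"
proof -
  let ?R = "{s :: nat set rel. Card_order s \<and> (\<forall>T. maximal_tower T \<longrightarrow> |T| \<le>o s)}"
  have "|UNIV :: nat set set| \<in> ?R"
    by (simp add: card_of_Card_order card_of_mono1)
  then obtain t where "t \<in> ?R" "\<forall>s\<in>?R. t \<le>o s"
    using exists_minim_Card_order[of ?R] by blast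
  then have "is_t_hat t" by (simp add: is_t_hat_def)
  then show ?thesis unfolding t_hat_def by (rule someI)
qed

lemma is_t_hat_least:
  fixes s :: "'a rel"
  assumes "Card_order s" and "\<And>T. maximal_tower T \<Longrightarrow> |T| \<le>o s"
  shows "t_hat \<le>o s"
proof (rule ccontr)
  assume "\<not> t_hat \<le>o s"
  moreover have t: "Card_order t_hat" using is_t_hat_t_hat by (simp add: is_t_hat_def)
  ultimately have less: "s <o t_hat"
    using assms(1) by (meson card_order_on_well_order_on not_ordLess_iff_ordLeq)
  then have "|Field s| \<le>o |Field t_hat|"
    using ordLess_imp_ordLeq card_of_mono2 by blast
  then obtain f where "inj_on f (Field s)" "f ` Field s \<subseteq> Field t_hat"
    using card_of_ordLeq[of "Field s" "Field t_hat"] by blast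
  then have "|Field s| =o |f ` Field s|"
    using card_of_ordIso[of "Field s" "f ` Field s"] inj_on_imp_bij_betw by blast
  then have iso: "s =o |f ` Field s|"
    using assms(1) card_of_Field_ordIso ordIso_symmetric ordIso_transitive by blast
  then have "\<forall>T. maximal_tower T \<longrightarrow> |T| \<le>o |f ` Field s|"
    using assms(2) ordLeq_ordIso_trans by blast
  then have "t_hat \<le>o |f ` Field s|"
    using is_t_hat_t_hat card_of_Card_order unfolding is_t_hat_def by blast
  then have "t_hat \<le>o s"
    using iso ordIso_symmetric ordLeq_ordIso_trans by blast
  then show False using less not_ordLess_ordLeq by blast
qed

end

theory Submission
  imports Defs
begin

text \<open>
  The quasi-order \<open>\<subseteq>\<^sup>*\<close> of almost inclusion on the subsets of \<open>\<omega>\<close> embeds into \<^const>\<open>W_omega\<close>,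
  and the combinatorics of \<open>\<subseteq>\<^sup>*\<close> then supplies the antichain and the chains.

  Left and right translations of the bicyclic monoid move a point a bounded distance in the grid
  \<open>\<omega> \<times> \<omega>\<close>. So let \<open>E\<close> be any set of natural numbers and let \<open>E\<^sub>n\<close> be its \<open>n\<close>-th halo, the points at
  distance at most \<open>n\<close> from \<open>E \<union> {0}\<close>. Remove from the grid the points of \<open>E\<^sub>n\<close> on each of the first
  \<open>n + 1\<close> horizontal and vertical lines, and add the zero. As \<open>n\<close> grows, these sets form a countable
  base at zero of a shift-continuous topology: the preimage under a translation of the \<open>n\<close>-th removed
  set lies in a later one. The topology is weak, because only finitely many lines are touched at each stage,
  and it is Hausdorff, because each point of the grid is removed eventually.

  The topology so obtained depends on the ideal generated by the finite sets and the integer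
  translates of \<open>E\<close>. In order to lose no more than finite sets, take \<open>E = {2 ^ j | j \<in> A}\<close>. The
  gaps between powers of two grow, so a fixed halo of one power contains no other power, with finitely
  many exceptions. Hence the topology of \<open>A\<close> is coarser than that of \<open>B\<close> exactly when \<open>A \<subseteq>\<^sup>* B\<close>
  (lemma \<open>halo_topology_le_iff\<close>).

  There are continuum many subsets of \<open>\<omega>\<close> pairwise incomparable under \<open>\<subseteq>\<^sup>*\<close>, which gives the
  antichain. Complementation turns a tower, ordered by reverse almost inclusion, into an
  increasing chain of topologies; an ordinal below \<^const>\<open>t_hat\<close> is order isomorphic to a
  proper initial segment of some maximal tower. Finally, a first-countable topology on a countable
  set has a countable base, so it is coded by a single sequence of bits; with the antichain this
  gives both cardinalities.
\<close>

section \<open>Topologies in which only zero is not isolated\<close>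

definition zero_base_topology ::
    "(nat \<Rightarrow> 'a::{semigroup_mult, mult_zero} set) \<Rightarrow> 'a topology" where
  "zero_base_topology N = topology (\<lambda>U. 0 \<in> U \<longrightarrow> (\<exists>n. N n \<subseteq> U))"

lemma openin_zero_base_topology:
  assumes "antimono N"
  shows "openin (zero_base_topology N) U \<longleftrightarrow> (0 \<in> U \<longrightarrow> (\<exists>n. N n \<subseteq> U))"
proof -
  have "istopology (\<lambda>U. 0 \<in> U \<longrightarrow> (\<exists>n. N n \<subseteq> U))"
    unfolding istopology_def
  proof (intro conjI allI impI)
    fix S T
    assume S: "0 \<in> S \<longrightarrow> (\<exists>n. N n \<subseteq> S)" and T: "0 \<in> T \<longrightarrow> (\<exists>n. N n \<subseteq> T)"
      and "0 \<in> S \<inter> T"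
    then obtain m n where "N m \<subseteq> S" "N n \<subseteq> T" by auto
    moreover have "N (max m n) \<subseteq> N m" "N (max m n) \<subseteq> N n"
      using assms by (simp_all add: antimonoD)
    ultimately show "\<exists>n. N n \<subseteq> S \<inter> T" by blast
  next
    fix K :: "'a set set"
    assume "\<forall>S\<in>K. 0 \<in> S \<longrightarrow> (\<exists>n. N n \<subseteq> S)" "0 \<in> \<Union>K"
    then show "\<exists>n. N n \<subseteq> \<Union>K" by (meson Sup_upper UnionE order_trans)
  qed
  then show ?thesis by (simp add: zero_base_topology_def)
qed

lemma topspace_zero_base_topology:
  assumes "antimono N"
  shows "topspace (zero_base_topology N) = UNIV"
  using openin_zero_base_topology[OF assms, of UNIV] openin_subset by blast

lemma Hausdorff_zero_base_topology:
  assumes N: "antimono N" and Inter: "(\<Inter>n. N n) \<subseteq> {0}"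
  shows "Hausdorff_space (zero_base_topology N)"
proof -
  have *: "\<exists>U V. openin (zero_base_topology N) U \<and> openin (zero_base_topology N) V \<and>
      x \<in> U \<and> y \<in> V \<and> disjnt U V" if "x \<noteq> y" "x \<noteq> 0" for x y
  proof -
    obtain n where "x \<notin> N n" using Inter \<open>x \<noteq> 0\<close> by auto
    then show ?thesis
      using that by (intro exI[of _ "{x}"] exI[of _ "- {x}"])
        (auto simp: openin_zero_base_topology[OF N] disjnt_def)
  qed
  show ?thesis
    unfolding Hausdorff_space_def
  proof (intro allI impI, elim conjE)
    fix x y :: 'a
    assume "x \<noteq> y"
    then consider "x \<noteq> 0" | "y \<noteq> 0" by blast
    then show "\<exists>U V. openin (zero_base_topology N) U \<and> openin (zero_base_topology N) V \<and>
        x \<in> U \<and> y \<in> V \<and> disjnt U V"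
    proof cases
      case 1
      then show ?thesis using *[of x y] \<open>x \<noteq> y\<close> by blast
    next
      case 2
      then show ?thesis using *[of y x] \<open>x \<noteq> y\<close> by (metis disjnt_sym)
    qed
  qed
qed

lemma first_countable_zero_base_topology:
  assumes N: "antimono N" and zero: "\<And>n. 0 \<in> N n"
  shows "first_countable (zero_base_topology N)"
  unfolding first_countable_def
proof
  fix x :: 'a
  show "\<exists>\<B>. countable \<B> \<and> (\<forall>V\<in>\<B>. openin (zero_base_topology N) V) \<and>
      (\<forall>U. openin (zero_base_topology N) U \<and> x \<in> U \<longrightarrow> (\<exists>V\<in>\<B>. x \<in> V \<and> V \<subseteq> U))"
  proof (cases "x = 0")
    case True
    then show ?thesis
      using zero by (intro exI[of _ "range N"]) (auto simp: openin_zero_base_topology[OF N])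
  next
    case False
    then show ?thesis by (intro exI[of _ "{{x}}"]) (auto simp: openin_zero_base_topology[OF N])
  qed
qed

text \<open>Translations fix zero and every other point is isolated, so continuity has to be tested at
  zero only.\<close>

lemma shift_continuous_zero_base_topology:
  assumes N: "antimono N"
    and shift: "\<And>a n. \<exists>m. \<forall>x \<in> N m. a * x \<in> N n \<and> x * a \<in> N n"
  shows "shift_continuous (zero_base_topology N)"
proof -
  have "\<exists>m. N m \<subseteq> {x. a * x \<in> U}" "\<exists>m. N m \<subseteq> {x. x * a \<in> U}"
    if "N n \<subseteq> U" for a n U
    using shift[of a n] that by blast+
  then show ?thesis
    by (auto simp: shift_continuous_def continuous_map_def topspace_zero_base_topology[OF N]
        openin_zero_base_topology[OF N])
qed

section \<open>The weak topology of a set of natural numbers\<close>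

text \<open>The two inequalities say \<open>\<bar>x - 2 ^ j\<bar> \<le> n\<close> without truncated subtraction.\<close>

definition halo :: "nat set \<Rightarrow> nat \<Rightarrow> nat set" where
  "halo A n = {x. x \<le> n \<or> (\<exists>j\<in>A. x \<le> 2 ^ j + n \<and> 2 ^ j \<le> x + n)}"

definition halo_nbhd :: "nat set \<Rightarrow> nat \<Rightarrow> bicyclic0 set" where
  "halo_nbhd A n =
     {0} \<union> {Elt k m | k m. (k \<le> n \<longrightarrow> m \<notin> halo A n) \<and> (m \<le> n \<longrightarrow> k \<notin> halo A n)}"

definition halo_topology :: "nat set \<Rightarrow> bicyclic0 topology" where
  "halo_topology A = zero_base_topology (halo_nbhd A)"

lemma halo_shift:
  assumes "x \<in> halo A n" "x \<le> y + k" "y \<le> x + k" "n + k \<le> m"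
  shows "y \<in> halo A m"
proof (cases "x \<le> n")
  case True
  then show ?thesis using assms by (simp add: halo_def)
next
  case False
  then obtain j where "j \<in> A" "x \<le> 2 ^ j + n" "2 ^ j \<le> x + n"
    using assms(1) by (auto simp: halo_def)
  then have "y \<le> 2 ^ j + m" "2 ^ j \<le> y + m" using assms by linarith+
  with \<open>j \<in> A\<close> show ?thesis by (auto simp: halo_def)
qed

lemma halo_shift_contra:
  assumes "y \<notin> halo A m" "x \<le> y + k" "y \<le> x + k" "n + k \<le> m"
  shows "x \<notin> halo A n"
  using assms halo_shift by blast

lemma halo_le: "x \<le> n \<Longrightarrow> x \<in> halo A n"
  by (simp add: halo_def)

lemma halo_mono: "n \<le> m \<Longrightarrow> halo A n \<subseteq> halo A m"
  using halo_shift[where k = 0] by auto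

lemma zero_in_halo_nbhd: "0 \<in> halo_nbhd A n"
  by (simp add: halo_nbhd_def)

lemma Elt_in_halo_nbhd_iff:
  "Elt k m \<in> halo_nbhd A n \<longleftrightarrow> (k \<le> n \<longrightarrow> m \<notin> halo A n) \<and> (m \<le> n \<longrightarrow> k \<notin> halo A n)"
  by (simp add: halo_nbhd_def zero_bicyclic0_def)

lemma halo_nbhd_subset:
  assumes "halo A n \<subseteq> halo B m" "n \<le> m"
  shows "halo_nbhd B m \<subseteq> halo_nbhd A n"
  using assms by (auto simp: halo_nbhd_def)

lemma antimono_halo_nbhd: "antimono (halo_nbhd A)"
  by (intro antimonoI halo_nbhd_subset halo_mono)

text \<open>A translation by \<open>(a, b)\<close> moves each coordinate by at most \<open>a + b\<close>. Passing from stage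
  \<open>n + a + b\<close> to stage \<open>n\<close> therefore absorbs it; at the boundary, where the product formula
  changes its shape, the coordinate of \<open>x\<close> that is cancelled is at most \<open>a + b\<close>, so \<open>x\<close> lies on one of
  the lines of the later stage.\<close>

lemma halo_nbhd_times_left:
  assumes "x \<in> halo_nbhd A (n + a + b)"
  shows "Elt a b * x \<in> halo_nbhd A n"
proof (cases x)
  case Zero
  then show ?thesis using zero_in_halo_nbhd by (simp add: zero_bicyclic0_def)
next
  case (Elt c d)
  have *: "c \<le> n + a + b \<longrightarrow> d \<notin> halo A (n + a + b)" "d \<le> n + a + b \<longrightarrow> c \<notin> halo A (n + a + b)"
    using assms by (simp_all add: Elt Elt_in_halo_nbhd_iff)
  show ?thesis
  proof (cases "b \<le> c")
    case True
    have "d \<notin> halo A n" if "a + c - b \<le> n"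
      using *(1) that True
      by - (rule halo_shift_contra[of d A "n + a + b" _ 0]; simp)
    moreover have "a + c - b \<notin> halo A n" if "d \<le> n"
      using *(2) that True
      by - (rule halo_shift_contra[of c A "n + a + b" _ "a + b"]; simp)
    ultimately show ?thesis using True by (simp add: Elt Elt_in_halo_nbhd_iff)
  next
    case False
    have "d + b - c \<notin> halo A n"
      using *(1) False
      by - (rule halo_shift_contra[of d A "n + a + b" _ "a + b"]; simp)
    moreover have "\<not> d + b - c \<le> n"
      using *(2) False halo_le[of c "n + a + b" A] by auto
    ultimately show ?thesis using False by (simp add: Elt Elt_in_halo_nbhd_iff)
  qed
qed

lemma halo_nbhd_times_right:
  assumes "x \<in> halo_nbhd A (n + a + b)"
  shows "x * Elt a b \<in> halo_nbhd A n"
proof (cases x)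
  case Zero
  then show ?thesis using zero_in_halo_nbhd by (simp add: zero_bicyclic0_def)
next
  case (Elt c d)
  have *: "c \<le> n + a + b \<longrightarrow> d \<notin> halo A (n + a + b)" "d \<le> n + a + b \<longrightarrow> c \<notin> halo A (n + a + b)"
    using assms by (simp_all add: Elt Elt_in_halo_nbhd_iff)
  show ?thesis
  proof (cases "d \<le> a")
    case True
    have "c + a - d \<notin> halo A n"
      using *(2) True
      by - (rule halo_shift_contra[of c A "n + a + b" _ "a + b"]; simp)
    moreover have "\<not> c + a - d \<le> n"
      using *(1) True halo_le[of d "n + a + b" A] by auto
    ultimately show ?thesis using True by (simp add: Elt Elt_in_halo_nbhd_iff)
  next
    case False
    have "b + d - a \<notin> halo A n" if "c \<le> n"
      using *(1) that False
      by - (rule halo_shift_contra[of d A "n + a + b" _ "a + b"]; simp)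
    moreover have "c \<notin> halo A n" if "b + d - a \<le> n"
      using *(2) that False
      by - (rule halo_shift_contra[of c A "n + a + b" _ 0]; simp)
    ultimately show ?thesis using False by (simp add: Elt Elt_in_halo_nbhd_iff)
  qed
qed

lemma halo_topology_in_W_omega: "halo_topology A \<in> W_omega"
proof -
  note N = antimono_halo_nbhd[of A]
  have "x = 0" if "\<And>n. x \<in> halo_nbhd A n" for x
  proof (cases x)
    case Zero
    then show ?thesis by (simp add: zero_bicyclic0_def)
  next
    case (Elt k m)
    then show ?thesis
      using that[of "max k m"] by (simp add: Elt_in_halo_nbhd_iff halo_le)
  qed
  then have "Hausdorff_space (halo_topology A)"
    unfolding halo_topology_def by (intro Hausdorff_zero_base_topology N) auto
  moreover have "shift_continuous (halo_topology A)"
    unfolding halo_topology_def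
  proof (intro shift_continuous_zero_base_topology N)
    fix a n
    show "\<exists>m. \<forall>x \<in> halo_nbhd A m. a * x \<in> halo_nbhd A n \<and> x * a \<in> halo_nbhd A n"
    proof (cases a)
      case Zero
      then show ?thesis
        using zero_in_halo_nbhd[of A n] by (metis mult_zero_left mult_zero_right zero_bicyclic0_def)
    next
      case (Elt c d)
      then show ?thesis using halo_nbhd_times_left halo_nbhd_times_right by blast
    qed
  qed
  moreover have "first_countable (halo_topology A)"
    unfolding halo_topology_def
    by (intro first_countable_zero_base_topology N zero_in_halo_nbhd)
  moreover have "C_nbhd n \<subseteq> halo_nbhd A n" for n
    by (auto simp: C_nbhd_def Elt_in_halo_nbhd_iff zero_in_halo_nbhd)
  then have "halo_topology A \<sqsubseteq>\<^sub>T tau_min"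
    by (auto simp: halo_topology_def topology_le_def openin_tau_min openin_zero_base_topology[OF N]
        intro: order_trans)
  ultimately show ?thesis
    by (simp add: W_omega_def SCT_omega_def halo_topology_def topspace_zero_base_topology[OF N])
qed

text \<open>Distinct powers of two differ by at least half of the larger one. If \<open>2 ^ j\<close> is within
  distance \<open>n\<close> of another power, then \<open>2 ^ j \<le> 2 * n\<close>, which only finitely many \<open>j\<close> satisfy.\<close>

lemma halo_reflects_membership:
  assumes "(2::nat) ^ j \<in> halo B n" "j \<notin> B"
  shows "j \<le> 2 * n"
proof -
  have "(2::nat) ^ j \<le> 2 * n"
  proof (cases "(2::nat) ^ j \<le> n")
    case False
    then obtain i where i: "i \<in> B" "(2::nat) ^ j \<le> 2 ^ i + n" "(2::nat) ^ i \<le> 2 ^ j + n"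
      using assms(1) by (auto simp: halo_def)
    with assms(2) consider "Suc i \<le> j" | "Suc j \<le> i" by (metis not_less_eq_eq le_antisym)
    then show ?thesis
    proof cases
      case 1
      then have "(2::nat) ^ Suc i \<le> 2 ^ j" by (intro power_increasing) auto
      then show ?thesis using i(2) by simp
    next
      case 2
      then have "(2::nat) ^ Suc j \<le> 2 ^ i" by (intro power_increasing) auto
      then show ?thesis using i(3) by simp
    qed
  qed simp
  then show ?thesis using less_exp[of j] by linarith
qed

text \<open>For sufficiency, the finitely many powers \<open>2 ^ j\<close> with \<open>j\<close> in \<open>A\<close> but not in \<open>B\<close> are at
  most some \<open>2 ^ M\<close>; the halo of \<open>A\<close> around them is swallowed by the initial segment that every
  halo contains, once the stage is increased by \<open>2 ^ M\<close>.\<close>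

theorem halo_topology_le_iff: "halo_topology A \<sqsubseteq>\<^sub>T halo_topology B \<longleftrightarrow> A \<subseteq>\<^sup>* B"
proof
  assume le: "halo_topology A \<sqsubseteq>\<^sub>T halo_topology B"
  have "openin (halo_topology A) (halo_nbhd A 0)"
    by (auto simp: halo_topology_def openin_zero_base_topology[OF antimono_halo_nbhd])
  with le have "openin (halo_topology B) (halo_nbhd A 0)" by (auto simp: topology_le_def)
  then obtain n where n: "halo_nbhd B n \<subseteq> halo_nbhd A 0"
    by (auto simp: halo_topology_def openin_zero_base_topology[OF antimono_halo_nbhd]
        zero_in_halo_nbhd)
  have "j \<le> 2 * n" if "j \<in> A" "j \<notin> B" for j
  proof -
    \<comment> \<open>The zeroth line witnesses the inclusion: there, \<open>2 ^ j\<close> is removed at once.\<close>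
    have "2 ^ j \<in> halo A 0" using \<open>j \<in> A\<close> by (auto simp: halo_def)
    then have "Elt 0 (2 ^ j) \<notin> halo_nbhd A 0" by (simp add: Elt_in_halo_nbhd_iff)
    then have "Elt 0 (2 ^ j) \<notin> halo_nbhd B n" using n by blast
    then have "2 ^ j \<in> halo B n" by (auto simp: Elt_in_halo_nbhd_iff intro: halo_le)
    then show ?thesis using halo_reflects_membership \<open>j \<notin> B\<close> by blast
  qed
  then have "A - B \<subseteq> {..2 * n}" by auto
  then show "A \<subseteq>\<^sup>* B" unfolding almost_subset_def by (rule finite_subset) simp
next
  assume "A \<subseteq>\<^sup>* B"
  then obtain M where M: "\<And>j. j \<in> A \<Longrightarrow> j \<notin> B \<Longrightarrow> j \<le> M"
    by (auto simp: almost_subset_def finite_nat_set_iff_bounded_le)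
  have "halo_nbhd B (n + 2 ^ M) \<subseteq> halo_nbhd A n" for n
  proof (intro halo_nbhd_subset subsetI)
    fix x assume x: "x \<in> halo A n"
    show "x \<in> halo B (n + 2 ^ M)"
    proof (cases "x \<le> n")
      case False
      then obtain j where j: "j \<in> A" "x \<le> 2 ^ j + n" "2 ^ j \<le> x + n"
        using x by (auto simp: halo_def)
      show ?thesis
      proof (cases "j \<in> B")
        case True
        then show ?thesis using j by (auto simp: halo_def intro!: bexI[of _ j])
      next
        case False
        then have "(2::nat) ^ j \<le> 2 ^ M" using M j(1) by (intro power_increasing) auto
        then show ?thesis using j by (intro halo_le) linarith
      qed
    qed (simp add: halo_le)
  qed simp
  then show "halo_topology A \<sqsubseteq>\<^sub>T halo_topology B"
    by (auto simp: halo_topology_def topology_le_def openin_zero_base_topology[OF antimono_halo_nbhd]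
        intro: order_trans)
qed

section \<open>An antichain of size continuum\<close>

lemma continuum_ordIso: "|UNIV :: (nat \<Rightarrow> bool) set| =o continuum"
proof -
  have "Func (UNIV :: nat set) (UNIV :: bool set) = UNIV" by (auto simp: Func_def)
  then show ?thesis
    by (simp add: continuum_def cexp_def ctwo_def Field_card_of Field_natLeq card_of_refl)
qed

text \<open>The set of \<open>f\<close> has infinitely many points in every column, and the value of \<open>f\<close> at \<open>n\<close>
  decides which half of column \<open>n\<close> is taken. Two functions that differ somewhere take
  disjoint infinite halves of a whole column.\<close>

definition parity_columns :: "(nat \<Rightarrow> bool) \<Rightarrow> nat set" where
  "parity_columns f = {prod_encode (n, k) | n k. even k = f n}"

lemma parity_columns_incomparable:
  assumes "f \<noteq> g"
  shows "\<not> parity_columns f \<subseteq>\<^sup>* parity_columns g"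
proof -
  obtain n where n: "f n \<noteq> g n" using assms by blast
  let ?h = "\<lambda>k. prod_encode (n, 2 * k + (if f n then 0 else 1))"
  have "range ?h \<subseteq> parity_columns f - parity_columns g"
    using n by (auto simp: parity_columns_def)
  moreover have "infinite (range ?h)" by (intro range_inj_infinite) (auto simp: inj_def)
  ultimately show ?thesis unfolding almost_subset_def using infinite_super by blast
qed

lemma antichain_in_W_omega:
  "\<exists>A \<subseteq> W_omega. topology_antichain A \<and> |A| =o continuum"
proof -
  let ?t = "\<lambda>f. halo_topology (parity_columns f)"
  have incomparable: "\<not> ?t f \<sqsubseteq>\<^sub>T ?t g" if "f \<noteq> g" for f g
    using that by (simp add: halo_topology_le_iff parity_columns_incomparable)
  have "inj ?t"
  proof (rule injI)
    fix f g assume "?t f = ?t g"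
    then have "?t f \<sqsubseteq>\<^sub>T ?t g" by (simp add: topology_le_def)
    then show "f = g" using incomparable by blast
  qed
  then have "|UNIV :: (nat \<Rightarrow> bool) set| =o |range ?t|"
    by (intro card_of_ordIsoI) (rule inj_on_imp_bij_betw)
  then have "|range ?t| =o continuum"
    using continuum_ordIso ordIso_symmetric ordIso_transitive by blast
  moreover have "topology_antichain (range ?t)"
    unfolding topology_antichain_def
  proof (rule pairwise_imageI)
    fix f g :: "nat \<Rightarrow> bool" assume "f \<noteq> g"
    then show "\<not> ?t f \<sqsubseteq>\<^sub>T ?t g \<and> \<not> ?t g \<sqsubseteq>\<^sub>T ?t f"
      using incomparable[of f g] incomparable[of g f] by simp
  qed
  moreover have "range ?t \<subseteq> W_omega" by (auto simp: halo_topology_in_W_omega)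
  ultimately show ?thesis by blast
qed

section \<open>Chains from towers\<close>

text \<open>If \<open>\<kappa>\<close> were at least as long as every maximal tower, its cardinality would bound the
  cardinalities of all of them, and hence bound their supremum.\<close>

lemma ordLess_t_hat_imp_maximal_tower:
  fixes \<kappa> :: "'k rel"
  assumes \<kappa>: "Well_order \<kappa>" and less: "\<kappa> <o t_hat"
  obtains T where "maximal_tower T" "\<kappa> <o {(x, y). x \<in> T \<and> y \<in> T \<and> y \<subseteq>\<^sup>* x}"
proof (rule ccontr)
  note witness = that
  assume no_thesis: "\<not> thesis"
  have no: "\<not> \<kappa> <o {(x, y). x \<in> T \<and> y \<in> T \<and> y \<subseteq>\<^sup>* x}" if "maximal_tower T" for T
    using witness[OF that] no_thesis by blast
  have "|T| \<le>o |Field \<kappa>|" if T: "maximal_tower T" for T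
  proof -
    let ?r = "{(x, y). x \<in> T \<and> y \<in> T \<and> y \<subseteq>\<^sup>* x}"
    have r: "well_order_on T ?r" using T by (simp add: maximal_tower_def tower_def)
    then have "|T| \<le>o ?r" by (rule card_of_least)
    also have "?r \<le>o \<kappa>"
      using no[OF T] \<kappa> r well_order_on_Well_order not_ordLess_iff_ordLeq by blast
    finally show ?thesis using card_of_mono2[of "|T|" \<kappa>] by (simp add: Field_card_of)
  qed
  then have "t_hat \<le>o |Field \<kappa>|" by (intro is_t_hat_least card_of_Card_order)
  also have "|Field \<kappa>| \<le>o \<kappa>" using \<kappa> by (rule card_of_least)
  finally show False using less not_ordLess_ordLeq by blast
qed

lemma chain_in_W_omega:
  fixes \<kappa> :: "'k rel"
  assumes "Well_order \<kappa>" "\<kappa> <o t_hat"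
  shows "\<exists>L \<subseteq> W_omega. well_order_on L (topology_order L) \<and> topology_order L =o \<kappa>"
proof -
  obtain T where T: "maximal_tower T" and less: "\<kappa> <o {(x, y). x \<in> T \<and> y \<in> T \<and> y \<subseteq>\<^sup>* x}"
      (is "_ <o ?r")
    using ordLess_t_hat_imp_maximal_tower assms by blast
  have r: "well_order_on T ?r" using T by (simp add: maximal_tower_def tower_def)
  then have wo: "Well_order ?r" and field: "Field ?r = T"
    using well_order_on_Well_order by blast+
  obtain a where iso: "\<kappa> =o Restr ?r (underS ?r a)"
    using less ordLess_iff_ordIso_Restr[OF wo assms(1)] by blast
  define A where "A = T \<inter> underS ?r a"
  define p where "p = Restr ?r A"
  have "p = Restr ?r (underS ?r a)" by (auto simp: p_def A_def)
  with iso have iso': "\<kappa> =o p" by simp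
  have p: "Well_order p" unfolding p_def using wo by (rule Well_order_Restr)
  have field_p: "Field p = A"
    using wo field unfolding p_def A_def
    by (simp add: well_order_on_def linear_order_on_def partial_order_on_def preorder_on_def
        Refl_Field_Restr2)
  let ?g = "\<lambda>B. halo_topology (- B)"
  have le: "?g B \<sqsubseteq>\<^sub>T ?g C \<longleftrightarrow> C \<subseteq>\<^sup>* B" for B C
    by (simp add: halo_topology_le_iff almost_subset_def Diff_eq Int_commute)
  have inj: "inj_on ?g (Field p)"
  proof (rule inj_onI)
    fix B C assume BC: "B \<in> Field p" "C \<in> Field p" and "?g B = ?g C"
    then have "B \<subseteq>\<^sup>* C" "C \<subseteq>\<^sup>* B" using le[of B C] le[of C B] by (auto simp: topology_le_def)
    then have "(B, C) \<in> ?r" "(C, B) \<in> ?r" using BC by (auto simp: field_p A_def)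
    then show "B = C"
      using r by (meson well_order_on_def linear_order_on_def partial_order_on_def antisymD)
  qed
  have "(B, C) \<in> p \<longleftrightarrow> B \<in> A \<and> C \<in> A \<and> ?g B \<sqsubseteq>\<^sub>T ?g C" for B C
    by (auto simp: p_def A_def le)
  then have order: "topology_order (?g ` A) = dir_image p ?g"
    unfolding topology_order_def dir_image_def by blast
  have "Well_order (dir_image p ?g)" using p inj by (rule Well_order_dir_image)
  moreover have "Field (dir_image p ?g) = ?g ` A" by (simp add: dir_image_Field field_p)
  moreover have "dir_image p ?g =o \<kappa>"
    using dir_image_ordIso[OF p inj] iso' ordIso_symmetric ordIso_transitive by blast
  ultimately show ?thesis
    using order halo_topology_in_W_omega by (intro exI[of _ "?g ` A"]) auto
qed

section \<open>Counting first-countable topologies\<close>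

instance bicyclic0 :: countable
  by countable_datatype

lemma countable_first_countable_imp_second_countable:
  assumes "first_countable X" "countable (topspace X)"
  shows "second_countable X"
proof -
  obtain \<B> where B: "\<And>x. x \<in> topspace X \<Longrightarrow> countable (\<B> x)"
      "\<And>x V. x \<in> topspace X \<Longrightarrow> V \<in> \<B> x \<Longrightarrow> openin X V"
      "\<And>x U. x \<in> topspace X \<Longrightarrow> openin X U \<Longrightarrow> x \<in> U \<Longrightarrow> \<exists>V\<in>\<B> x. x \<in> V \<and> V \<subseteq> U"
    using assms(1) unfolding first_countable_def by metis
  show ?thesis
    unfolding second_countable_def
  proof (intro exI conjI allI impI)
    show "countable (\<Union>x\<in>topspace X. \<B> x)" using assms(2) B(1) by blast
    show "\<forall>V\<in>(\<Union>x\<in>topspace X. \<B> x). openin X V" using B(2) by blast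
    fix U x assume "openin X U \<and> x \<in> U"
    then show "\<exists>V\<in>(\<Union>x\<in>topspace X. \<B> x). x \<in> V \<and> V \<subseteq> U"
      using B(3) openin_subset by (metis UN_I subsetD)
  qed
qed

text \<open>A sequence of bits codes a sequence of subsets of the countable type, read as a base; every
  second-countable topology is generated by such a base.\<close>

lemma card_second_countable_topologies:
  "|{X :: 'a::countable topology. second_countable X}| \<le>o continuum"
proof -
  let ?V = "\<lambda>p n. {x :: 'a. p (to_nat (n :: nat, x))}"
  let ?dec = "\<lambda>p. topology (arbitrary union_of (\<lambda>V. V \<in> range (?V p)))"
  have "X \<in> range ?dec" if X: "second_countable X" for X :: "'a topology"
  proof -
    obtain \<B> where B: "countable \<B>" "\<And>V. V \<in> \<B> \<Longrightarrow> openin X V"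
        "\<And>U x. openin X U \<Longrightarrow> x \<in> U \<Longrightarrow> \<exists>V\<in>\<B>. x \<in> V \<and> V \<subseteq> U"
      using X unfolding second_countable_def by metis
    \<comment> \<open>The empty set is added because only nonempty countable sets are ranges of sequences.\<close>
    define e where "e = from_nat_into (insert {} \<B>)"
    have e: "range e = insert {} \<B>"
      unfolding e_def using B(1) by (intro range_from_nat_into) auto
    define p where "p i = (case from_nat i of (n, x) \<Rightarrow> x \<in> e n)" for i
    have "?V p n = e n" for n by (simp add: p_def)
    with e have "range (?V p) = insert {} \<B>" by simp
    then have base: "V \<in> range (?V p) \<longleftrightarrow> V = {} \<or> V \<in> \<B>" for V by simp
    have "?dec p = X"
    proof (rule topology_base_unique)
      fix V assume "V \<in> range (?V p)"
      with base B(2) show "openin X V" by (metis openin_empty)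
    next
      fix U x assume "openin X U" "x \<in> U"
      with B(3) base show "\<exists>V. V \<in> range (?V p) \<and> x \<in> V \<and> V \<subseteq> U" by metis
    qed
    then show ?thesis by blast
  qed
  then have "{X :: 'a topology. second_countable X} \<subseteq> range ?dec" by blast
  then have "|{X :: 'a topology. second_countable X}| \<le>o |UNIV :: (nat \<Rightarrow> bool) set|"
    by (rule surj_imp_ordLeq)
  then show ?thesis using continuum_ordIso ordLeq_ordIso_trans by blast
qed

lemma card_SCT_omega_le: "|SCT_omega| \<le>o continuum"
proof -
  have "SCT_omega \<subseteq> {X. second_countable X}"
    by (auto simp: SCT_omega_def intro: countable_first_countable_imp_second_countable)
  then show ?thesis
    using card_of_mono1 card_second_countable_topologies ordLeq_transitive by blast
qed

theorem theorem2p2: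
  shows "(\<exists>A \<subseteq> W_omega. topology_antichain A \<and> |A| =o continuum) \<and>
         (\<forall>\<kappa> :: 'k rel. Well_order \<kappa> \<and> \<kappa> <o t_hat \<longrightarrow>
            (\<exists>L \<subseteq> W_omega. well_order_on L (topology_order L) \<and> topology_order L =o \<kappa>)) \<and>
         |W_omega| =o continuum \<and> |SCT_omega| =o continuum"
proof -
  obtain A where A: "A \<subseteq> W_omega" "|A| =o continuum"
    using antichain_in_W_omega by blast
  have "continuum \<le>o |W_omega|"
    using A card_of_mono1 ordIso_symmetric ordIso_ordLeq_trans by blast
  moreover have "|W_omega| \<le>o |SCT_omega|"
    by (intro card_of_mono1) (auto simp: W_omega_def)
  ultimately have "|W_omega| =o continuum" "|SCT_omega| =o continuum"
    using card_SCT_omega_le ordLeq_transitive ordIso_iff_ordLeq by blast+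
  then show ?thesis using antichain_in_W_omega chain_in_W_omega by blast
qed

end
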